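(* Let $\mathcal{H}_0$ be the class of $2$-edge extremal minimal bipartite matching covered graphs and $\mathcal{H}_1$ the class of $2$-edge $n$-extremal minimal bipartite matching covered graphs. Then $\mathcal{H}_1\subset\mathcal{H}_0$ (a proper containment).
   Context: All graphs are finite and loopless; parallel edges are allowed. For a graph $G=(V,E)$ write $n=|V|$ and $m=|E|$. A connected graph on four or more vertices is matching covered if every edge lies in some perfect matching. A matching covered graph is minimal if deleting any single edge yields a graph that is not matching covered. $E_2$ is the set of edges both of whose ends have degree two. A minimal bipartite matching covered graph is $2$-edge extremal if $|E_2|=m-n+2$, and $2$-edge $n$-extremal if $|E_2|=\frac{n+10}{6}$. Classes are regarded up to isomorphism. *)

theory Defs
  imports Complex_Main
begin

record ('v, 'e) multigraph =
  verts :: "'v set"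
  edges :: "'e set"
  ends :: "'e \<Rightarrow> 'v set"

text \<open>Edges are labelled, so parallel edges are distinct labels with the same ends;
  an edge has two distinct ends, so there are no loops.\<close>

definition finite_loopless :: "('v, 'e) multigraph \<Rightarrow> bool" where
  "finite_loopless G \<longleftrightarrow> finite (verts G) \<and> finite (edges G) \<and>
     (\<forall>e\<in>edges G. ends G e \<subseteq> verts G \<and> card (ends G e) = 2)"

definition degree :: "('v, 'e) multigraph \<Rightarrow> 'v \<Rightarrow> nat" where
  "degree G v = card {e \<in> edges G. v \<in> ends G e}"

definition adjacent :: "('v, 'e) multigraph \<Rightarrow> ('v \<times> 'v) set" where
  "adjacent G = {(u, v). \<exists>e\<in>edges G. ends G e = {u, v}}"

definition connected_graph :: "('v, 'e) multigraph \<Rightarrow> bool" where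
  "connected_graph G \<longleftrightarrow> verts G \<noteq> {} \<and>
     (\<forall>u\<in>verts G. \<forall>v\<in>verts G. (u, v) \<in> (adjacent G)\<^sup>*)"

definition bipartite :: "('v, 'e) multigraph \<Rightarrow> bool" where
  "bipartite G \<longleftrightarrow> (\<exists>A B. A \<union> B = verts G \<and> A \<inter> B = {} \<and>
     (\<forall>e\<in>edges G. \<exists>a\<in>A. \<exists>b\<in>B. ends G e = {a, b}))"

definition perfect_matching :: "('v, 'e) multigraph \<Rightarrow> 'e set \<Rightarrow> bool" where
  "perfect_matching G M \<longleftrightarrow> M \<subseteq> edges G \<and> (\<forall>v\<in>verts G. \<exists>!e. e \<in> M \<and> v \<in> ends G e)"

definition matching_covered :: "('v, 'e) multigraph \<Rightarrow> bool" where
  "matching_covered G \<longleftrightarrow> finite_loopless G \<and> connected_graph G \<and> card (verts G) \<ge> 4 \<and>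
     (\<forall>e\<in>edges G. \<exists>M. perfect_matching G M \<and> e \<in> M)"

definition delete_edge :: "('v, 'e) multigraph \<Rightarrow> 'e \<Rightarrow> ('v, 'e) multigraph" where
  "delete_edge G e = G\<lparr>edges := edges G - {e}\<rparr>"

definition minimal_matching_covered :: "('v, 'e) multigraph \<Rightarrow> bool" where
  "minimal_matching_covered G \<longleftrightarrow> matching_covered G \<and>
     (\<forall>e\<in>edges G. \<not> matching_covered (delete_edge G e))"

definition E2 :: "('v, 'e) multigraph \<Rightarrow> 'e set" where
  "E2 G = {e \<in> edges G. \<forall>v\<in>ends G e. degree G v = 2}"

definition two_edge_extremal :: "('v, 'e) multigraph set" where
  "two_edge_extremal = {G. minimal_matching_covered G \<and> bipartite G \<and>
     int (card (E2 G)) = int (card (edges G)) - int (card (verts G)) + 2}"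

definition two_edge_n_extremal :: "('v, 'e) multigraph set" where
  "two_edge_n_extremal = {G. minimal_matching_covered G \<and> bipartite G \<and>
     real (card (E2 G)) = (real (card (verts G)) + 10) / 6}"

definition isomorphic :: "('v, 'e) multigraph \<Rightarrow> ('w, 'f) multigraph \<Rightarrow> bool" where
  "isomorphic G H \<longleftrightarrow> (\<exists>\<phi> \<psi>. bij_betw \<phi> (verts G) (verts H) \<and> bij_betw \<psi> (edges G) (edges H) \<and>
     (\<forall>e\<in>edges G. ends H (\<psi> e) = \<phi> ` ends G e))"

definition iso_rel :: "(('v, 'e) multigraph \<times> ('v, 'e) multigraph) set" where
  "iso_rel = {(G, H). finite_loopless G \<and> finite_loopless H \<and> isomorphic G H}"

definition iso_classes :: "('v, 'e) multigraph set \<Rightarrow> ('v, 'e) multigraph set set" where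
  "iso_classes C = C // iso_rel"

lemma isomorphic_refl: "isomorphic G G"
  unfolding isomorphic_def by (rule exI[of _ id], rule exI[of _ id]) (simp add: bij_betw_def)

lemma isomorphic_sym:
  assumes "finite_loopless G" "isomorphic G H"
  shows "isomorphic H G"
proof -
  obtain f g where f: "bij_betw f (verts G) (verts H)" and g: "bij_betw g (edges G) (edges H)"
    and e: "\<forall>e\<in>edges G. ends H (g e) = f ` ends G e"
    using assms(2) unfolding isomorphic_def by blast
  let ?f = "inv_into (verts G) f" and ?g = "inv_into (edges G) g"
  have "ends G (?g x) = ?f ` ends H x" if x: "x \<in> edges H" for x
  proof -
    have gx: "?g x \<in> edges G" "g (?g x) = x"
      using x bij_betwE[OF bij_betw_inv_into[OF g]] bij_betw_inv_into_right[OF g] by auto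
    then have "ends H x = f ` ends G (?g x)" using e by metis
    moreover have "ends G (?g x) \<subseteq> verts G"
      using gx assms(1) by (simp add: finite_loopless_def)
    ultimately show ?thesis
      using f by (simp add: bij_betw_def inv_into_image_cancel)
  qed
  then show ?thesis
    unfolding isomorphic_def using bij_betw_inv_into[OF f] bij_betw_inv_into[OF g] by blast
qed

lemma isomorphic_trans:
  assumes "isomorphic G H" "isomorphic H K"
  shows "isomorphic G K"
proof -
  obtain f g where fg: "bij_betw f (verts G) (verts H)" "bij_betw g (edges G) (edges H)"
    "\<forall>e\<in>edges G. ends H (g e) = f ` ends G e"
    using assms(1) unfolding isomorphic_def by blast
  obtain f' g' where fg': "bij_betw f' (verts H) (verts K)" "bij_betw g' (edges H) (edges K)"
    "\<forall>e\<in>edges H. ends K (g' e) = f' ` ends H e"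
    using assms(2) unfolding isomorphic_def by blast
  have "\<forall>e\<in>edges G. ends K ((g' \<circ> g) e) = (f' \<circ> f) ` ends G e"
    using fg fg' bij_betwE[OF fg(2)] by (simp add: image_comp)
  then show ?thesis
    unfolding isomorphic_def
    using bij_betw_trans[OF fg(1) fg'(1)] bij_betw_trans[OF fg(2) fg'(2)] by blast
qed

lemma equiv_iso_rel: "equiv {G. finite_loopless G} iso_rel"
  unfolding equiv_def refl_on_def sym_def trans_def iso_rel_def
  by (auto intro: isomorphic_refl isomorphic_sym isomorphic_trans)

text \<open>Isomorphism types of finite loopless graphs can be represented over the natural
  numbers.\<close>

lemma ex_isomorphic_nat:
  assumes "finite_loopless G"
  shows "\<exists>H :: (nat, nat) multigraph. finite_loopless H \<and> isomorphic G H"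
proof -
  obtain f :: "_ \<Rightarrow> nat" where f: "inj_on f (verts G)"
    using assms finite_imp_inj_to_nat_seg[of "verts G"] unfolding finite_loopless_def by blast
  obtain g :: "_ \<Rightarrow> nat" where g: "inj_on g (edges G)"
    using assms finite_imp_inj_to_nat_seg[of "edges G"] unfolding finite_loopless_def by blast
  define H where "H = \<lparr>verts = f ` verts G, edges = g ` edges G,
    ends = (\<lambda>x. f ` ends G (inv_into (edges G) g x))\<rparr>"
  have "card (f ` ends G e) = 2" if "e \<in> edges G" for e
    using that assms card_image[OF inj_on_subset[OF f]] unfolding finite_loopless_def by simp
  then have "finite_loopless H"
    using assms g unfolding finite_loopless_def H_def by auto
  moreover have "isomorphic G H"
    unfolding isomorphic_def H_def using f g
    by (intro exI[of _ f] exI[of _ g]) (auto simp: bij_betw_def)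
  ultimately show ?thesis by blast
qed

end

theory Submission
  imports Defs
begin

text \<open>A connected bipartite graph with sides \<open>A\<close> and \<open>B\<close> of equal size is matching covered iff
  \<open>card X < card (N X)\<close> for all nonempty proper subsets \<open>X\<close> of \<open>A\<close> (Hall). Call an edge critical
  if deleting it destroys this surplus condition. The main step is
  \<open>card C + 2 \<le> n + card E\<^sub>2\<close> for the set \<open>C\<close> of critical edges. A critical edge in a graph with
  more than four vertices yields a nontrivial tight cut; an edge critical in the graph is critical
  in one of the two contractions of the cut, which are smaller and have \<open>n + 2\<close> vertices together,
  and so the bound follows by induction. In a minimal graph every edge is critical, hence
  \<open>card E\<^sub>2 \<ge> m - n + 2\<close>. Counting degrees gives \<open>card E\<^sub>2 \<ge> 6n - 5m\<close>, and the two inequalities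
  force equality in the first one when \<open>6 * card E\<^sub>2 = n + 10\<close>. The theta graph with four paths of
  length three has \<open>n = 10\<close>, \<open>m = 12\<close> and \<open>card E\<^sub>2 = 4\<close>, so the containment is proper.\<close>

section \<open>Surplus, critical edges and tight cuts\<close>

definition nbrs :: "('e \<Rightarrow> 'a) \<Rightarrow> ('e \<Rightarrow> 'b) \<Rightarrow> 'e set \<Rightarrow> 'a set \<Rightarrow> 'b set" where
  "nbrs s t E X = t ` {e \<in> E. s e \<in> X}"

text \<open>The full side is excluded because in a \<open>bigraph\<close> its neighbourhood is
  capped by \<open>card B = card A\<close>.\<close>

definition surplus :: "'a set \<Rightarrow> ('e \<Rightarrow> 'a) \<Rightarrow> ('e \<Rightarrow> 'b) \<Rightarrow> 'e set \<Rightarrow> bool" where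
  "surplus A s t E \<longleftrightarrow> (\<forall>X. X \<noteq> {} \<and> X \<subset> A \<longrightarrow> card X < card (nbrs s t E X))"

definition critical :: "'a set \<Rightarrow> ('e \<Rightarrow> 'a) \<Rightarrow> ('e \<Rightarrow> 'b) \<Rightarrow> 'e set \<Rightarrow> 'e set" where
  "critical A s t E = {e \<in> E. \<not> surplus A s t (E - {e})}"

definition fibre :: "('e \<Rightarrow> 'a) \<Rightarrow> 'e set \<Rightarrow> 'a \<Rightarrow> 'e set" where
  "fibre s E a = {e \<in> E. s e = a}"

definition twos :: "('e \<Rightarrow> 'a) \<Rightarrow> ('e \<Rightarrow> 'b) \<Rightarrow> 'e set \<Rightarrow> 'e set" where
  "twos s t E = {e \<in> E. card (fibre s E (s e)) = 2 \<and> card (fibre t E (t e)) = 2}"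

section \<open>Degrees and critical edges under the surplus condition\<close>

locale bigraph =
  fixes A :: "'a set" and B :: "'b set" and s :: "'e \<Rightarrow> 'a" and t :: "'e \<Rightarrow> 'b" and E :: "'e set"
  assumes finA: "finite A" and finB: "finite B" and finE: "finite E"
    and card_eq: "card A = card B"
    and s_in: "e \<in> E \<Longrightarrow> s e \<in> A" and t_in: "e \<in> E \<Longrightarrow> t e \<in> B"
begin

lemma finite_nbrs [simp]: "finite (nbrs s t E X)"
  by (simp add: nbrs_def finE)

lemma bigraph_subset: "F \<subseteq> E \<Longrightarrow> bigraph A B s t F"
  by unfold_locales (use finA finB finE card_eq s_in t_in in \<open>auto intro: finite_subset\<close>)

lemma nbrs_subset: "nbrs s t E X \<subseteq> B"
  using t_in by (auto simp: nbrs_def)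

lemma surplusD: "surplus A s t E \<Longrightarrow> X \<noteq> {} \<Longrightarrow> X \<subset> A \<Longrightarrow> card X + 1 \<le> card (nbrs s t E X)"
  by (auto simp: surplus_def Suc_le_eq)

text \<open>Already \<open>A\<close> minus one vertex has at least \<open>card A\<close> neighbours,
  and \<open>B\<close> is no larger.\<close>

lemma nbrs_all:
  assumes "surplus A s t E" "card A \<ge> 2"
  shows "nbrs s t E A = B"
proof -
  have "A \<noteq> {}" using assms(2) by auto
  then obtain a where a: "a \<in> A" by auto
  have ca: "card (A - {a}) = card A - 1" using a finA by simp
  have "A - {a} \<noteq> {}" using ca assms(2) by (intro notI) simp
  then have "card (A - {a}) + 1 \<le> card (nbrs s t E (A - {a}))"
    using a by (intro surplusD[OF assms(1)]) auto
  also have "\<dots> \<le> card (nbrs s t E A)"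
    by (rule card_mono) (auto simp: nbrs_def finE)
  finally have "card B \<le> card (nbrs s t E A)" using ca card_eq assms(2) by linarith
  then show ?thesis using nbrs_subset finB by (meson card_seteq)
qed

lemma card_fibre_s:
  assumes "surplus A s t E" "card A \<ge> 2" "a \<in> A"
  shows "2 \<le> card (fibre s E a)"
proof -
  have "{a} \<noteq> A" using assms(2) by auto
  then have "card {a} + 1 \<le> card (nbrs s t E {a})"
    using assms by (intro surplusD) auto
  also have "nbrs s t E {a} = t ` fibre s E a" by (auto simp: nbrs_def fibre_def)
  also have "card (t ` fibre s E a) \<le> card (fibre s E a)"
    by (rule card_image_le) (simp add: fibre_def finE)
  finally show ?thesis by simp
qed

text \<open>Removing the other end of the only edge at \<open>b\<close> would leave a set violating the surplus.\<close>

lemma card_fibre_t: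
  assumes "surplus A s t E" "card A \<ge> 2" "b \<in> B"
  shows "2 \<le> card (fibre t E b)"
proof (rule ccontr)
  assume n: "\<not> 2 \<le> card (fibre t E b)"
  have "b \<in> nbrs s t E A" using nbrs_all assms by blast
  then obtain e where e: "e \<in> E" "t e = b" by (auto simp: nbrs_def)
  have "finite (fibre t E b)" by (simp add: fibre_def finE)
  moreover have "e \<in> fibre t E b" using e by (simp add: fibre_def)
  moreover have "card (fibre t E b) \<le> Suc 0" using n by linarith
  ultimately have u: "f = e" if "f \<in> fibre t E b" for f
    using that by (auto simp: card_le_Suc0_iff_eq)
  have ca: "card (A - {s e}) = card A - 1" using e s_in finA by simp
  have "card (A - {s e}) + 1 \<le> card (nbrs s t E (A - {s e}))"
  proof (rule surplusD[OF assms(1)])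
    show "A - {s e} \<noteq> {}" using ca assms(2) by (intro notI) simp
  qed (use e s_in in auto)
  also have "\<dots> \<le> card (B - {b})"
  proof (rule card_mono)
    show "nbrs s t E (A - {s e}) \<subseteq> B - {b}" using u t_in by (auto simp: nbrs_def fibre_def)
  qed (simp add: finB)
  also have "\<dots> = card A - 1" using assms(3) finB card_eq by simp
  finally show False using ca assms(2) by linarith
qed

text \<open>Deleting \<open>e\<close> would leave at most one edge at \<open>s e\<close>, whereas
  the surplus condition forces degree at least two.\<close>

lemma fibre_s_critical:
  assumes "card A \<ge> 2" "e \<in> E" "card (fibre s E (s e)) \<le> 2"
  shows "e \<in> critical A s t E"
proof (rule ccontr)
  assume "e \<notin> critical A s t E"
  then have "surplus A s t (E - {e})" using assms(2) by (simp add: critical_def)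
  then have "2 \<le> card (fibre s (E - {e}) (s e))"
    using bigraph.card_fibre_s[OF bigraph_subset, of "E - {e}" "s e"] assms s_in by blast
  also have "fibre s (E - {e}) (s e) = fibre s E (s e) - {e}" by (auto simp: fibre_def)
  also have "card \<dots> = card (fibre s E (s e)) - 1" using assms(2) by (simp add: fibre_def)
  finally show False using assms(3) by linarith
qed

lemma fibre_t_critical:
  assumes "card A \<ge> 2" "e \<in> E" "card (fibre t E (t e)) \<le> 2"
  shows "e \<in> critical A s t E"
proof (rule ccontr)
  assume "e \<notin> critical A s t E"
  then have "surplus A s t (E - {e})" using assms(2) by (simp add: critical_def)
  then have "2 \<le> card (fibre t (E - {e}) (t e))"
    using bigraph.card_fibre_t[OF bigraph_subset, of "E - {e}" "t e"] assms t_in by blast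
  also have "fibre t (E - {e}) (t e) = fibre t E (t e) - {e}" by (auto simp: fibre_def)
  also have "card \<dots> = card (fibre t E (t e)) - 1" using assms(2) by (simp add: fibre_def)
  finally show False using assms(3) by linarith
qed

text \<open>Deleting one edge can cost a set only one neighbour, so a set that the deletion spoils
  has surplus exactly one and reaches \<open>t e\<close> only through \<open>e\<close>.\<close>

lemma critical_witness:
  assumes "surplus A s t E" "e \<in> critical A s t E"
  obtains X where "X \<noteq> {}" "X \<subset> A" "s e \<in> X" "t e \<notin> nbrs s t (E - {e}) X"
    "card (nbrs s t (E - {e}) X) = card X" "card (nbrs s t E X) = card X + 1"
proof -
  obtain X where X: "X \<noteq> {}" "X \<subset> A" "\<not> card X < card (nbrs s t (E - {e}) X)"
    using assms(2) by (auto simp: critical_def surplus_def)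
  have 1: "card X + 1 \<le> card (nbrs s t E X)" using surplusD assms(1) X by blast
  have fin: "finite (nbrs s t (E - {e}) X)" by (simp add: nbrs_def finE)
  have sX: "s e \<in> X"
  proof (rule ccontr)
    assume "s e \<notin> X"
    then have "nbrs s t (E - {e}) X = nbrs s t E X" by (auto simp: nbrs_def)
    then show False using 1 X by simp
  qed
  have ins: "nbrs s t E X = insert (t e) (nbrs s t (E - {e}) X)"
    using sX assms(2) by (auto simp: nbrs_def critical_def)
  have nin: "t e \<notin> nbrs s t (E - {e}) X"
  proof
    assume "t e \<in> nbrs s t (E - {e}) X"
    then have "nbrs s t E X = nbrs s t (E - {e}) X" using ins by (simp only: insert_absorb)
    then show False using 1 X(3) by simp
  qed
  have c: "card (nbrs s t E X) = Suc (card (nbrs s t (E - {e}) X))"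
    using ins nin fin by simp
  then have "card (nbrs s t (E - {e}) X) = card X" "card (nbrs s t E X) = card X + 1"
    using X(3) 1 by linarith+
  with X sX nin show ?thesis by (intro that)
qed

end

section \<open>The two contractions of a tight cut\<close>

text \<open>The cut of the shore \<open>X \<union> Y\<close> is tight. Instead of adding new vertices, the contractions reuse
  \<open>z\<close> and \<open>w\<close> as names of the contracted complement and of the contracted shore.\<close>

locale tight_cut = bigraph +
  fixes X Y z w
  assumes X_sub: "X \<subseteq> A" and Y_sub: "Y \<subseteq> B" and card_Y: "card Y = card X + 1"
    and z_in: "z \<in> A - X" and w_in: "w \<in> Y"
    and X_ne: "X \<noteq> {}" and card_X: "card X + 2 \<le> card A"
    and no_exit: "e \<in> E \<Longrightarrow> s e \<in> X \<Longrightarrow> t e \<in> Y"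
begin

definition s1 where "s1 e = (if s e \<in> X then s e else z)"
definition t2 where "t2 e = (if t e \<in> Y then w else t e)"

lemma finX: "finite X" and finY: "finite Y"
  using X_sub Y_sub finA finB finite_subset by blast+

lemma card_AX: "card (A - X) = card A - card X"
  using X_sub finX by (simp add: card_Diff_subset)

lemma card_BY: "card (B - Y) + 1 = card (A - X)"
  using Y_sub finY card_Y card_AX card_X card_eq by (simp add: card_Diff_subset)

lemma bigraph1: "bigraph (insert z X) Y s1 t {e \<in> E. t e \<in> Y}"
  by unfold_locales (use finX finY finE card_Y z_in in \<open>auto simp: s1_def\<close>)

lemma bigraph2: "bigraph (A - X) (insert w (B - Y)) s t2 {e \<in> E. s e \<notin> X}"
  by unfold_locales (use finA finB finE card_BY w_in s_in t_in in \<open>auto simp: t2_def\<close>)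

lemma surplus1:
  assumes "surplus A s t E"
  shows "surplus (insert z X) s1 t {e \<in> E. t e \<in> Y}"
  unfolding surplus_def
proof (intro allI impI, elim conjE)
  fix W assume W: "W \<noteq> {}" "W \<subset> insert z X"
  let ?N = "nbrs s1 t {e \<in> E. t e \<in> Y} W"
  have finW: "finite W" using W finX by (meson finite_insert finite_subset psubset_imp_subset)
  have finN: "finite ?N" by (simp add: nbrs_def finE)
  show "card W < card ?N"
  proof (cases "z \<in> W")
    case False
    then have WX: "W \<subseteq> X" using W by auto
    have "nbrs s t E W \<subseteq> ?N"
      using False WX no_exit by (force simp: nbrs_def s1_def image_iff)
    moreover have "W \<subset> A" using WX X_sub z_in by auto
    then have "card W + 1 \<le> card (nbrs s t E W)" using surplusD[OF assms W(1)] by blast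
    ultimately show ?thesis using card_mono[OF finN, of "nbrs s t E W"] by linarith
  next
    case True
    \<comment> \<open>The contracted vertex \<open>z\<close> is expanded back to
      \<open>A - X\<close>. The neighbours gained outside \<open>Y\<close> number at most
      \<open>card (B - Y)\<close>, which is one less than \<open>card (A - X)\<close>.\<close>
    let ?W = "(W - {z}) \<union> (A - X)"
    obtain x where "x \<in> X" "x \<notin> W" using W(2) True by blast
    moreover have "W \<subseteq> insert z X" using W(2) by (rule psubset_imp_subset)
    ultimately have "?W \<subseteq> A" "x \<in> A" "x \<notin> ?W" using X_sub z_in by auto
    then have "?W \<subset> A" by (metis psubsetI)
    moreover have "?W \<noteq> {}" using z_in by blast
    ultimately have 1: "card ?W + 1 \<le> card (nbrs s t E ?W)" by (intro surplusD[OF assms])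
    have "card ?W = card (W - {z}) + card (A - X)"
      by (rule card_Un_disjoint) (use finW finA W in auto)
    then have 2: "card ?W + 1 = card W + card (A - X)"
      using True finW by (metis Suc_eq_plus1 add_Suc card_Suc_Diff1)
    have "nbrs s t E ?W \<subseteq> ?N \<union> (B - Y)"
    proof
      fix y assume "y \<in> nbrs s t E ?W"
      then obtain e where e: "e \<in> E" "y = t e" "s e \<in> ?W" by (auto simp: nbrs_def)
      then have "s1 e \<in> W" using True by (auto simp: s1_def)
      then show "y \<in> ?N \<union> (B - Y)" using e t_in by (auto simp: nbrs_def)
    qed
    then have "card (nbrs s t E ?W) \<le> card (?N \<union> (B - Y))"
      using finN finB by (intro card_mono) auto
    also have "\<dots> \<le> card ?N + card (B - Y)" by (rule card_Un_le)
    finally show ?thesis using 1 2 card_BY by linarith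
  qed
qed

lemma surplus2:
  assumes "surplus A s t E"
  shows "surplus (A - X) s t2 {e \<in> E. s e \<notin> X}"
  unfolding surplus_def
proof (intro allI impI, elim conjE)
  fix W assume W: "W \<noteq> {}" "W \<subset> A - X"
  let ?N = "nbrs s t2 {e \<in> E. s e \<notin> X} W"
  have finW: "finite W" using W finA by (meson finite_Diff finite_subset psubset_imp_subset)
  have finN: "finite ?N" by (simp add: nbrs_def finE)
  show "card W < card ?N"
  proof (cases "\<exists>e\<in>E. s e \<in> W \<and> t e \<in> Y")
    case False
    have "nbrs s t E W \<subseteq> ?N"
    proof
      fix y assume "y \<in> nbrs s t E W"
      then obtain e where e: "e \<in> E" "y = t e" "s e \<in> W" by (auto simp: nbrs_def)
      then have "y = t2 e" "s e \<notin> X" using False W by (auto simp: t2_def)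
      then show "y \<in> ?N" unfolding nbrs_def using e by (intro image_eqI[of _ _ e]) auto
    qed
    moreover have "W \<subset> A" using W X_sub by auto
    then have "card W + 1 \<le> card (nbrs s t E W)" using surplusD[OF assms W(1)] by blast
    ultimately show ?thesis using card_mono[OF finN, of "nbrs s t E W"] by linarith
  next
    case True
    then obtain e where e: "e \<in> E" "s e \<in> W" "t e \<in> Y" by blast
    have wN: "w \<in> ?N"
      unfolding nbrs_def by (rule image_eqI[of _ _ e]) (use e W in \<open>auto simp: t2_def\<close>)
    \<comment> \<open>All neighbours in \<open>Y\<close> collapse to the single vertex
      \<open>w\<close>, which \<open>W\<close> reaches already. Hence \<open>X\<close> can be added
      to \<open>W\<close>, and \<open>card Y = card X + 1\<close> balances the count.\<close>
    have "W \<union> X \<subset> A" using W X_sub by auto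
    then have 1: "card (W \<union> X) + 1 \<le> card (nbrs s t E (W \<union> X))" 
      using W by (intro surplusD[OF assms]) auto
    have 2: "card (W \<union> X) = card W + card X"
      by (rule card_Un_disjoint) (use finW finX W in auto)
    have "nbrs s t E (W \<union> X) \<subseteq> Y \<union> (?N - {w})"
    proof
      fix y assume "y \<in> nbrs s t E (W \<union> X)"
      then obtain e where e: "e \<in> E" "y = t e" "s e \<in> W \<union> X" by (auto simp: nbrs_def)
      show "y \<in> Y \<union> (?N - {w})"
      proof (cases "y \<in> Y")
        case False
        then have y: "y = t2 e" "s e \<notin> X" "y \<noteq> w" using e no_exit w_in by (auto simp: t2_def)
        then have "y \<in> ?N" unfolding nbrs_def using e by (intro image_eqI[of _ _ e]) auto
        then show ?thesis using y by simp
      qed simp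
    qed
    then have "card (nbrs s t E (W \<union> X)) \<le> card (Y \<union> (?N - {w}))"
      using finN finY by (intro card_mono) auto
    also have "\<dots> \<le> card Y + card (?N - {w})" by (rule card_Un_le)
    finally have "card (nbrs s t E (W \<union> X)) \<le> card Y + (card ?N - 1)" using wN by simp
    moreover have "card ?N > 0" using wN finN by (auto simp: card_gt_0_iff)
    ultimately show ?thesis using 1 2 card_Y by linarith
  qed
qed

text \<open>The converse of \<open>surplus1\<close> and \<open>surplus2\<close>, for subsets
  \<open>F\<close> so that it applies after an edge deletion. A set \<open>W\<close> is split along
  \<open>X\<close> and its neighbourhood along \<open>Y\<close>; each piece is bounded in its own
  contraction.\<close>

lemma surplus_glue:
  assumes F: "F \<subseteq> E"
    and S1: "surplus (insert z X) s1 t {e \<in> F. t e \<in> Y}"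
    and S2: "surplus (A - X) s t2 {e \<in> F. s e \<notin> X}"
  shows "surplus A s t F"
  unfolding surplus_def
proof (intro allI impI, elim conjE)
  fix W assume W: "W \<noteq> {}" "W \<subset> A"
  interpret G1: bigraph "insert z X" Y s1 t "{e \<in> F. t e \<in> Y}"
    by (rule bigraph.bigraph_subset[OF bigraph1]) (use F in auto)
  interpret G2: bigraph "A - X" "insert w (B - Y)" s t2 "{e \<in> F. s e \<notin> X}"
    by (rule bigraph.bigraph_subset[OF bigraph2]) (use F in auto)
  let ?N1 = "nbrs s1 t {e \<in> F. t e \<in> Y}" and ?N2 = "nbrs s t2 {e \<in> F. s e \<notin> X}"
  let ?N = "nbrs s t F W"
  have finF: "finite F" using F finE finite_subset by blast
  have finW: "finite W" using W finA by (meson finite_subset psubset_imp_subset)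
  have finN: "finite ?N" by (simp add: nbrs_def finF)
  have cW: "card W = card (W \<inter> X) + card (W - X)"
    using finW by (simp add: card_Int_Diff)
  have cN: "card ?N = card (?N \<inter> Y) + card (?N - Y)"
    using finN by (simp add: card_Int_Diff)
  have inX: "card (W \<inter> X) + 1 \<le> card (?N \<inter> Y)" if "W \<inter> X \<noteq> {}"
  proof -
    have "card (W \<inter> X) + 1 \<le> card (?N1 (W \<inter> X))"
      using that z_in by (intro G1.surplusD[OF S1]) auto
    also have "\<dots> \<le> card (?N \<inter> Y)"
      using z_in finN by (intro card_mono) (auto simp: nbrs_def s1_def split: if_splits)
    finally show ?thesis .
  qed
  have sub2: "?N2 (W - X) - {w} \<subseteq> ?N - Y"
    by (auto simp: nbrs_def t2_def split: if_splits)
  show "card W < card ?N"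
  proof (cases "W - X = {}")
    case True
    then have "W \<inter> X \<noteq> {}" using W(1) by blast
    then have "card (W \<inter> X) + 1 \<le> card (?N \<inter> Y)" by (rule inX)
    moreover have "card (W - X) = 0" by (simp only: True card.empty)
    ultimately show ?thesis using cW cN by linarith
  next
    case ne: False
    show ?thesis
    proof (cases "W - X = A - X")
      case True
      \<comment> \<open>Since \<open>W\<close> contains all of \<open>A - X\<close>, the vertex
        \<open>z\<close> may be added in the first contraction. The extra neighbour in
        \<open>Y\<close> makes up for \<open>card (B - Y)\<close> being one less than
        \<open>card (A - X)\<close>.\<close>
      let ?W = "insert z (W \<inter> X)"
      obtain x where x: "x \<in> A" "x \<notin> W" using W(2) by blast
      then have "x \<in> X" using True by auto
      then have "x \<in> insert z X" "x \<notin> ?W" using x z_in by auto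
      moreover have "?W \<subseteq> insert z X" by auto
      ultimately have "?W \<subset> insert z X" by (metis psubsetI)
      then have "card ?W + 1 \<le> card (?N1 ?W)"
        by (intro G1.surplusD[OF S1]) auto
      moreover have "card ?W = card (W \<inter> X) + 1" using finW z_in by simp
      moreover have "card (?N1 ?W) \<le> card (?N \<inter> Y)"
      proof (rule card_mono)
        show "?N1 ?W \<subseteq> ?N \<inter> Y"
        proof
          fix y assume "y \<in> ?N1 ?W"
          then obtain e where e: "e \<in> F" "t e \<in> Y" "y = t e" "s1 e \<in> ?W" by (auto simp: nbrs_def)
          have "s e \<in> A" using e F s_in by auto
          then have "s e \<in> W" using e True z_in by (auto simp: s1_def split: if_splits)
          then show "y \<in> ?N \<inter> Y" using e by (auto simp: nbrs_def)
        qed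
      qed (simp add: finN)
      moreover have "?N2 (W - X) = insert w (B - Y)"
        using G2.nbrs_all[OF S2] True card_X card_AX by simp
      then have "B - Y \<subseteq> ?N - Y" using sub2 w_in by auto
      then have "card (B - Y) \<le> card (?N - Y)" using finN by (intro card_mono) auto
      moreover have "card (W - X) = card (A - X)" by (simp only: True)
      ultimately show ?thesis using cW cN card_BY by linarith
    next
      case False
      then have "W - X \<subset> A - X" using W(2) by (intro psubsetI) auto
      then have 2: "card (W - X) + 1 \<le> card (?N2 (W - X))"
        using ne by (intro G2.surplusD[OF S2]) auto
      show ?thesis
      \<comment> \<open>The vertex \<open>w\<close> can use up the surplus of \<open>W - X\<close>.
        This happens only if \<open>W\<close> has a neighbour in \<open>Y\<close>, and then
        \<open>Y\<close> contributes at least one more than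
        \<open>card (W \<inter> X)\<close>.\<close>
      proof (cases "W \<inter> X = {} \<and> ?N \<inter> Y = {}")
        case True
        have "?N2 (W - X) \<subseteq> ?N"
        proof
          fix y assume "y \<in> ?N2 (W - X)"
          then obtain e where e: "e \<in> F" "s e \<in> W" "y = t2 e" by (auto simp: nbrs_def)
          then have "t e \<in> ?N" by (auto simp: nbrs_def)
          then show "y \<in> ?N" using True e by (auto simp: t2_def)
        qed
        then have "card (?N2 (W - X)) \<le> card ?N" using finN by (intro card_mono)
        then show ?thesis using 2 cW True by simp
      next
        case n: False
        have "card (?N2 (W - X)) \<le> card (?N2 (W - X) - {w}) + 1"
          by (simp add: card_Diff_singleton_if) linarith
        also have "\<dots> \<le> card (?N - Y) + 1"
          using sub2 finN by (simp add: card_mono)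
        finally have "card (W - X) \<le> card (?N - Y)" using 2 by simp
        moreover have "card (W \<inter> X) + 1 \<le> card (?N \<inter> Y)"
        proof (cases "W \<inter> X = {}")
          case True
          then have "?N \<inter> Y \<noteq> {}" using n by simp
          then have "card (?N \<inter> Y) > 0" using finN by (simp add: card_gt_0_iff)
          then show ?thesis using True by simp
        qed (rule inX)
        ultimately show ?thesis using cW cN by linarith
      qed
    qed
  qed
qed

end

section \<open>How critical edges and edges with two ends of degree two pass to the
  contractions\<close>

context tight_cut
begin

text \<open>The edge sets \<open>EY\<close> and \<open>EZ\<close> of the contractions cover
  \<open>E\<close> by \<open>no_exit\<close> and share exactly the edges of the cut,
  \<open>coboundary\<close>.\<close>

definition "EY = {e \<in> E. t e \<in> Y}"
definition "EZ = {e \<in> E. s e \<notin> X}"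
definition "crit1 = critical (insert z X) s1 t EY"
definition "crit2 = critical (A - X) s t2 EZ"
definition "coboundary = {e \<in> E. t e \<in> Y \<and> s e \<notin> X}"

text \<open>Deletion commutes with contraction: if both contractions survive the loss of
  \<open>e\<close>, then by \<open>surplus_glue\<close> so does the whole graph.\<close>

lemma critical_split:
  assumes "surplus A s t E"
  shows "critical A s t E \<subseteq> crit1 \<union> crit2"
proof
  fix e assume e: "e \<in> critical A s t E"
  show "e \<in> crit1 \<union> crit2"
  proof (rule ccontr)
    assume n: "e \<notin> crit1 \<union> crit2"
    have "{f \<in> E - {e}. t f \<in> Y} = EY - {e}" "{f \<in> E - {e}. s f \<notin> X} = EZ - {e}"
      by (auto simp: EY_def EZ_def)
    moreover have "surplus (insert z X) s1 t (EY - {e})"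
    proof (cases "e \<in> EY")
      case True
      then show ?thesis using n by (simp add: crit1_def critical_def)
    qed (use surplus1[OF assms] in \<open>simp add: EY_def\<close>)
    moreover have "surplus (A - X) s t2 (EZ - {e})"
    proof (cases "e \<in> EZ")
      case True
      then show ?thesis using n by (simp add: crit2_def critical_def)
    qed (use surplus2[OF assms] in \<open>simp add: EZ_def\<close>)
    ultimately have "surplus A s t (E - {e})" by (intro surplus_glue) auto
    then show False using e by (simp add: critical_def)
  qed
qed

lemma fibre_z: "fibre s1 EY z = coboundary"
  using z_in by (auto simp: fibre_def s1_def EY_def coboundary_def)

lemma fibre_w: "fibre t2 EZ w = coboundary"
  using w_in no_exit by (auto simp: fibre_def t2_def EZ_def coboundary_def)

lemma fibre_s1: "e \<in> E \<Longrightarrow> s e \<in> X \<Longrightarrow> fibre s1 EY (s1 e) = fibre s E (s e)"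
  using z_in no_exit by (auto simp: fibre_def s1_def EY_def)

lemma fibre_t1: "e \<in> EY \<Longrightarrow> fibre t EY (t e) = fibre t E (t e)"
  by (auto simp: fibre_def EY_def)

lemma fibre_s2: "e \<in> EZ \<Longrightarrow> fibre s EZ (s e) = fibre s E (s e)"
  by (auto simp: fibre_def EZ_def)

lemma fibre_t2: "e \<in> E \<Longrightarrow> t e \<notin> Y \<Longrightarrow> fibre t2 EZ (t2 e) = fibre t E (t e)"
  using w_in no_exit by (auto simp: fibre_def t2_def EZ_def)

lemma s1_cut: "e \<in> coboundary \<Longrightarrow> s1 e = z" and t2_cut: "e \<in> coboundary \<Longrightarrow> t2 e = w"
  by (auto simp: coboundary_def s1_def t2_def)

lemma card_insert_zX: "card (insert z X) = card X + 1"
  using z_in finX by simp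

lemma card_X_pos: "card X \<ge> 1"
  using X_ne finX by (simp add: Suc_le_eq card_gt_0_iff)

lemma card_cut:
  assumes "surplus A s t E"
  shows "card coboundary \<ge> 2"
  using bigraph.card_fibre_s[OF bigraph1 surplus1[OF assms], of z] card_insert_zX card_X_pos
  by (simp add: fibre_z flip: EY_def)

text \<open>Cut edges are the edges at \<open>z\<close> in the first contraction and at
  \<open>w\<close> in the second, so in both they meet a vertex of degree two.\<close>

lemma cut_critical:
  assumes "card coboundary = 2"
  shows "coboundary \<subseteq> crit1 \<inter> crit2"
proof
  fix e assume e: "e \<in> coboundary"
  then have "e \<in> EY" "e \<in> EZ" by (auto simp: coboundary_def EY_def EZ_def)
  then have "e \<in> crit1"
    using bigraph.fibre_s_critical[OF bigraph1, of e] e card_insert_zX card_X_pos assms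
    by (simp add: crit1_def s1_cut fibre_z flip: EY_def)
  moreover have "e \<in> crit2"
    using bigraph.fibre_t_critical[OF bigraph2, of e] \<open>e \<in> EZ\<close> e card_AX card_X assms
    by (simp add: crit2_def t2_cut fibre_w flip: EZ_def)
  ultimately show "e \<in> crit1 \<inter> crit2" by simp
qed

text \<open>If the cut has two edges, a contracted vertex has degree two, so cut edges may become members
  of \<open>twos\<close> in the contractions. The resulting excess of at most two is paid for by the cut edges, which
  are critical in both contractions.\<close>

lemma card_twos_split:
  assumes "surplus A s t E"
  shows "card (twos s1 t EY) + card (twos s t2 EZ) \<le> card (twos s t E) + card (crit1 \<inter> crit2)"
proof -
  \<comment> \<open>With \<open>?R\<close> these are the edges of \<open>twos s t E\<close> inside
    the shore, outside it and in the cut; by \<open>no_exit\<close> they are disjoint.\<close>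
  let ?P = "{e \<in> twos s t E. s e \<in> X}" and ?Q = "{e \<in> twos s t E. t e \<notin> Y}"
  let ?R = "twos s t E \<inter> coboundary"
  have fin: "finite (twos s t E)" "finite coboundary" by (auto simp: twos_def coboundary_def finE)
  have "card (?P \<union> ?Q \<union> ?R) \<le> card (twos s t E)"
    using fin by (intro card_mono) auto
  moreover have "card (?P \<union> ?Q) = card ?P + card ?Q"
    by (rule card_Un_disjoint) (use finE no_exit in \<open>auto simp: twos_def\<close>)
  moreover have "card (?P \<union> ?Q \<union> ?R) = card (?P \<union> ?Q) + card ?R"
    by (rule card_Un_disjoint) (use fin in \<open>auto simp: coboundary_def\<close>)
  ultimately have low: "card ?P + card ?Q + card ?R \<le> card (twos s t E)" by linarith
  show ?thesis
  proof (cases "card coboundary = 2")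
    case False
    \<comment> \<open>Both \<open>z\<close> and \<open>w\<close> now have degree above two, so no
      cut edge lies in \<open>twos\<close> of either contraction.\<close>
    then have 3: "card coboundary > 2" using card_cut[OF assms] by linarith
    have "twos s1 t EY \<subseteq> ?P"
    proof
      fix e assume e: "e \<in> twos s1 t EY"
      then have eE: "e \<in> E" "e \<in> EY" by (auto simp: twos_def EY_def)
      have "s e \<in> X"
      proof (rule ccontr)
        assume "s e \<notin> X"
        then have "e \<in> coboundary" using eE by (auto simp: coboundary_def EY_def)
        then show False using e 3 by (simp add: twos_def s1_cut fibre_z)
      qed
      then show "e \<in> ?P" using e eE by (simp add: twos_def fibre_s1 fibre_t1)
    qed
    then have "card (twos s1 t EY) \<le> card ?P" using fin by (intro card_mono) auto
    moreover have "twos s t2 EZ \<subseteq> ?Q"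
    proof
      fix e assume e: "e \<in> twos s t2 EZ"
      then have eE: "e \<in> E" "e \<in> EZ" by (auto simp: twos_def EZ_def)
      have "t e \<notin> Y"
      proof
        assume "t e \<in> Y"
        then have "e \<in> coboundary" using eE by (auto simp: coboundary_def EZ_def)
        then show False using e 3 by (simp add: twos_def t2_cut fibre_w)
      qed
      then show "e \<in> ?Q" using e eE by (simp add: twos_def fibre_s2 fibre_t2)
    qed
    then have "card (twos s t2 EZ) \<le> card ?Q" using fin by (intro card_mono) auto
    ultimately show ?thesis using low by linarith
  next
    case True
    \<comment> \<open>The cut edges that can lie in \<open>twos\<close> of each contraction: the
      contracted end has degree two there, so only the other end matters. Edges in both
      \<open>?D1\<close> and \<open>?D2\<close> lie in \<open>?R\<close>, hence the excess is at
      most \<open>card coboundary\<close>.\<close>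
    let ?D1 = "{e \<in> coboundary. card (fibre t E (t e)) = 2}" and ?D2 = "{e \<in> coboundary. card (fibre s E (s e)) = 2}"
    have "twos s1 t EY \<subseteq> ?P \<union> ?D1"
    proof
      fix e assume e: "e \<in> twos s1 t EY"
      then have eE: "e \<in> E" "e \<in> EY" by (auto simp: twos_def EY_def)
      show "e \<in> ?P \<union> ?D1"
      proof (cases "s e \<in> X")
        case True
        then show ?thesis using e eE by (simp add: twos_def fibre_s1 fibre_t1)
      next
        case False
        then have "e \<in> coboundary" using eE by (auto simp: coboundary_def EY_def)
        then show ?thesis using e eE by (simp add: twos_def fibre_t1)
      qed
    qed
    then have "card (twos s1 t EY) \<le> card (?P \<union> ?D1)" using fin by (intro card_mono) auto
    also have "\<dots> \<le> card ?P + card ?D1" by (rule card_Un_le)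
    finally have 1: "card (twos s1 t EY) \<le> card ?P + card ?D1" .
    have "twos s t2 EZ \<subseteq> ?Q \<union> ?D2"
    proof
      fix e assume e: "e \<in> twos s t2 EZ"
      then have eE: "e \<in> E" "e \<in> EZ" by (auto simp: twos_def EZ_def)
      show "e \<in> ?Q \<union> ?D2"
      proof (cases "t e \<in> Y")
        case False
        then show ?thesis using e eE by (simp add: twos_def fibre_s2 fibre_t2)
      next
        case True
        then have "e \<in> coboundary" using eE by (auto simp: coboundary_def EZ_def)
        then show ?thesis using e eE by (simp add: twos_def fibre_s2)
      qed
    qed
    then have "card (twos s t2 EZ) \<le> card (?Q \<union> ?D2)" using fin by (intro card_mono) auto
    also have "\<dots> \<le> card ?Q + card ?D2" by (rule card_Un_le)
    finally have 2: "card (twos s t2 EZ) \<le> card ?Q + card ?D2" .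
    have "card ?D1 + card ?D2 = card (?D1 \<union> ?D2) + card (?D1 \<inter> ?D2)"
      using fin by (intro card_Un_Int) auto
    moreover have "card (?D1 \<union> ?D2) \<le> card coboundary" using fin by (intro card_mono) auto
    moreover have "card (?D1 \<inter> ?D2) \<le> card ?R"
      using fin by (intro card_mono) (auto simp: twos_def coboundary_def)
    moreover have "card coboundary \<le> card (crit1 \<inter> crit2)"
      using cut_critical[OF True] finE
      by (intro card_mono) (auto simp: crit1_def critical_def EY_def)
    ultimately show ?thesis using 1 2 low by linarith
  qed
qed

end

section \<open>Graphs on four vertices\<close>

lemma (in bigraph) parallel_not_critical:
  assumes "surplus A s t E" "e \<in> critical A s t E" "f \<in> E" "s f = s e" "t f = t e"
  shows "f = e"
proof (rule ccontr)
  assume "f \<noteq> e"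
  have "nbrs s t (E - {e}) X = nbrs s t E X" for X
  proof (intro equalityI subsetI)
    fix y assume "y \<in> nbrs s t E X"
    then obtain g where g: "g \<in> E" "s g \<in> X" "y = t g" by (auto simp: nbrs_def)
    define h where "h = (if g = e then f else g)"
    have "h \<in> E - {e}" "s h \<in> X" "y = t h" using g assms \<open>f \<noteq> e\<close> by (auto simp: h_def)
    then show "y \<in> nbrs s t (E - {e}) X" by (auto simp: nbrs_def)
  qed (auto simp: nbrs_def)
  then have "surplus A s t (E - {e})" using assms(1) by (simp add: surplus_def)
  then show False using assms(2) by (simp add: critical_def)
qed

text \<open>Critical edges have no parallel copies, so they occupy distinct pairs among the four in
  \<open>A \<times> B\<close>. If all four are occupied, the graph is a 4-cycle and every edge
  counts in \<open>twos\<close>; with three, the edge opposite the remaining pair has two ends of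
  degree two.\<close>

lemma (in bigraph) four_vertices:
  assumes S: "surplus A s t E" and c: "card A = 2"
  shows "card (critical A s t E) \<le> 2 + card (twos s t E)"
proof (cases "critical A s t E \<subseteq> twos s t E")
  case True
  then have "card (critical A s t E) \<le> card (twos s t E)"
    by (intro card_mono) (auto simp: twos_def finE)
  then show ?thesis by simp
next
  case False
  let ?C = "critical A s t E"
  have CE: "?C \<subseteq> E" by (auto simp: critical_def)
  have finC: "finite ?C" using CE finE finite_subset by blast
  let ?st = "\<lambda>e. (s e, t e)"
  have inj: "inj_on ?st ?C"
    using parallel_not_critical[OF S] CE by (intro inj_onI) (metis prod.inject subsetD)
  have sub: "?st ` ?C \<subseteq> A \<times> B" using CE s_in t_in by auto
  have cAB: "card (A \<times> B) = 4" using c card_eq by (simp add: card_cartesian_product)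
  have "?st ` ?C \<noteq> A \<times> B"
  proof
    assume all: "?st ` ?C = A \<times> B"
    have uniq: "f = g" if "f \<in> E" "g \<in> E" "s f = s g" "t f = t g" for f g
    proof -
      have "(s f, t f) \<in> ?st ` ?C" using all that s_in t_in by auto
      then obtain h where "h \<in> ?C" "s h = s f" "t h = t f" by auto
      then show ?thesis using parallel_not_critical[OF S] that by metis
    qed
    have fA: "card (fibre s E a) \<le> 2" for a
    proof -
      have "card (fibre s E a) = card (t ` fibre s E a)"
        by (rule card_image[symmetric]) (auto intro!: inj_onI uniq simp: fibre_def)
      also have "\<dots> \<le> card B" using finB t_in by (intro card_mono) (auto simp: fibre_def)
      finally show ?thesis using c card_eq by simp
    qed
    have fB: "card (fibre t E b) \<le> 2" for b
    proof -
      have "card (fibre t E b) = card (s ` fibre t E b)"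
        by (rule card_image[symmetric]) (auto intro!: inj_onI uniq simp: fibre_def)
      also have "\<dots> \<le> card A" using finA s_in by (intro card_mono) (auto simp: fibre_def)
      finally show ?thesis using c by simp
    qed
    have "e \<in> twos s t E" if "e \<in> E" for e
      using fA[of "s e"] fB[of "t e"] card_fibre_s[OF S _ s_in[OF that]]
        card_fibre_t[OF S _ t_in[OF that]] c that by (auto simp: twos_def)
    then show False using False CE by auto
  qed
  then have psub: "?st ` ?C \<subset> A \<times> B" using sub by (rule psubsetI[rotated])
  then have "card (?st ` ?C) < 4"
    unfolding cAB[symmetric] using finA finB by (intro psubset_card_mono) auto
  then have lt4: "card ?C < 4" using card_image[OF inj] by simp
  show ?thesis
  proof (cases "card ?C = 3")
    case False
    then show ?thesis using lt4 by linarith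
  next
    case True
    have "card (A \<times> B - ?st ` ?C) = 1"
      using sub finC True cAB card_image[OF inj] by (subst card_Diff_subset) auto
    then obtain p where "A \<times> B - ?st ` ?C = {p}" by (auto simp: card_1_singleton_iff)
    then obtain a0 b0 where ab0: "A \<times> B - ?st ` ?C = {(a0, b0)}" by (cases p) auto
    then have ab: "a0 \<in> A" "b0 \<in> B" by auto
    obtain a1 where a1: "A = {a0, a1}" "a0 \<noteq> a1"
      using c ab(1) by (auto simp: card_2_iff)
    obtain b1 where b1: "B = {b0, b1}" "b0 \<noteq> b1"
      using c card_eq ab(2) by (auto simp: card_2_iff)
    have rest: "(a1, b1) \<in> ?st ` ?C" "(a1, b0) \<in> ?st ` ?C" "(a0, b1) \<in> ?st ` ?C"
      using ab0 a1 b1 by auto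
    then obtain e f g where e: "e \<in> ?C" "s e = a1" "t e = b1"
      and f: "f \<in> ?C" "s f = a1" "t f = b0" and g: "g \<in> ?C" "s g = a0" "t g = b1"
      by auto
    \<comment> \<open>Noncritical edges can only join \<open>a0\<close> and \<open>b0\<close>, so
      \<open>a1\<close> and \<open>b1\<close> meet critical edges only.\<close>
    have "fibre s E a1 = {e, f}"
    proof (intro equalityI subsetI)
      fix h assume "h \<in> fibre s E a1"
      then have h: "h \<in> E" "s h = a1" by (auto simp: fibre_def)
      then have "t h = b0 \<or> t h = b1" using t_in b1 by blast
      then show "h \<in> {e, f}" using parallel_not_critical[OF S] h e f by auto
    qed (use e f CE in \<open>auto simp: fibre_def\<close>)
    moreover have "fibre t E b1 = {e, g}"
    proof (intro equalityI subsetI)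
      fix h assume "h \<in> fibre t E b1"
      then have h: "h \<in> E" "t h = b1" by (auto simp: fibre_def)
      then have "s h = a0 \<or> s h = a1" using s_in a1 by blast
      then show "h \<in> {e, g}" using parallel_not_critical[OF S] h e g by auto
    qed (use e g CE in \<open>auto simp: fibre_def\<close>)
    moreover have "e \<noteq> f" "e \<noteq> g" using e f g a1 b1 by auto
    ultimately have "e \<in> twos s t E" using e CE by (auto simp: twos_def)
    then have "card (twos s t E) > 0" using finE by (auto simp: card_gt_0_iff twos_def)
    then show ?thesis using True by linarith
  qed
qed

section \<open>Tight sets and the bound on critical edges by induction\<close>

lemma (in bigraph) critical_tight_set:
  assumes S: "surplus A s t E" and e: "e \<in> critical A s t E" and c: "card A \<noteq> 2"
  obtains X where "X \<noteq> {}" "X \<subseteq> A" "card X + 2 \<le> card A" "card (nbrs s t E X) = card X + 1"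
proof -
  obtain X where X: "X \<noteq> {}" "X \<subset> A" "s e \<in> X" "t e \<notin> nbrs s t (E - {e}) X"
    "card (nbrs s t (E - {e}) X) = card X" "card (nbrs s t E X) = card X + 1"
    using critical_witness[OF S e] by metis
  have lt: "card X < card A" using X(2) finA by (simp add: psubset_card_mono)
  have finX: "finite X" using X(2) finA by (meson finite_subset psubset_imp_subset)
  show ?thesis
  proof (cases "card X + 2 \<le> card A")
    case True
    then show ?thesis using X by (intro that[of X]) auto
  next
    case False
    \<comment> \<open>Here \<open>X\<close> misses a single vertex of \<open>A\<close>. Dropping
      \<open>s e\<close> also loses the neighbour \<open>t e\<close>, so the smaller set again has
      surplus one; it is nonempty because \<open>card A\<close> is not two.\<close>
    let ?X = "X - {s e}"
    have cX: "card ?X + 1 = card X" using X finX by (metis Suc_eq_plus1 card_Suc_Diff1)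
    have "card X \<noteq> 1" using False lt c by linarith
    moreover have "card X > 0" using X(1) finX by (simp add: card_gt_0_iff)
    ultimately have "card ?X > 0" using cX by linarith
    then have ne: "?X \<noteq> {}" by (metis card.empty less_irrefl)
    have sub: "?X \<subset> A" using X(2) by (rule le_less_trans[rotated]) auto
    have "nbrs s t E ?X \<subseteq> nbrs s t (E - {e}) X" by (auto simp: nbrs_def)
    then have "card (nbrs s t E ?X) \<le> card (nbrs s t (E - {e}) X)"
      by (rule card_mono[rotated]) (simp add: nbrs_def finE)
    moreover have "card ?X + 1 \<le> card (nbrs s t E ?X)" by (rule surplusD[OF S ne sub])
    ultimately have "card (nbrs s t E ?X) = card ?X + 1" using cX X(5) by linarith
    then show ?thesis using ne sub cX lt by (intro that[of ?X]) auto
  qed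
qed

text \<open>Counting the critical edges, instead of assuming every edge critical, lets the induction
  run: a contraction may create parallel edges, which are not critical.\<close>

theorem card_critical_le:
  fixes A :: "'a set" and B :: "'b set" and s :: "'e \<Rightarrow> 'a"
  assumes "bigraph A B s t E" "surplus A s t E" "A \<noteq> {}"
  shows "card (critical A s t E) + 2 \<le> 2 * card A + card (twos s t E)"
  using assms
proof (induction "card A" arbitrary: A B s t E rule: less_induct)
  case less
  interpret bigraph A B s t E by (rule less.prems)
  note S = \<open>surplus A s t E\<close>
  have pos: "card A > 0" using less.prems finA by (simp add: card_gt_0_iff)
  \<comment> \<open>For \<open>card A = 1\<close> the surplus condition is vacuous and no edge is
    critical, so this falls under the first case.\<close>
  consider "critical A s t E = {}" | "card A = 2"
    | X where "X \<noteq> {}" "X \<subseteq> A" "card X + 2 \<le> card A" "card (nbrs s t E X) = card X + 1"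
    using critical_tight_set[OF S] by blast
  then show ?case
  proof cases
    case 1
    then show ?thesis using pos by simp
  next
    case 2
    then show ?thesis using four_vertices[OF S 2] by simp
  next
    case (3 X)
    let ?Y = "nbrs s t E X"
    have finX: "finite X" using 3(2) finA finite_subset by blast
    have "X \<noteq> A" using 3(3) by auto
    then obtain z where z: "z \<in> A - X" using 3(2) by blast
    have "?Y \<noteq> {}" using 3(4) by auto
    then obtain w where w: "w \<in> ?Y" by blast
    interpret tight_cut A B s t E X ?Y z w
      by unfold_locales (use 3 z w nbrs_subset in \<open>auto simp: nbrs_def\<close>)
    have 1: "card crit1 + 2 \<le> 2 * (card X + 1) + card (twos s1 t EY)"
      unfolding crit1_def card_insert_zX[symmetric]
      using bigraph1 surplus1[OF S] card_insert_zX 3(3)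
      by (intro less.hyps) (auto simp flip: EY_def)
    have 2: "card crit2 + 2 \<le> 2 * card (A - X) + card (twos s t2 EZ)"
      unfolding crit2_def
      using bigraph2 surplus2[OF S] card_AX card_X_pos pos z
      by (intro less.hyps) (auto simp flip: EZ_def)
    have fin: "finite crit1" "finite crit2"
      by (auto simp: crit1_def crit2_def critical_def EY_def EZ_def finE)
    \<comment> \<open>Edges critical in both contractions are counted twice; this saving is what
      \<open>card_twos_split\<close> spends. The sides of the contractions add up to
      \<open>card A + 1\<close>, which turns the constant 4 into 2.\<close>
    have "card (critical A s t E) \<le> card (crit1 \<union> crit2)"
      using critical_split[OF S] fin by (intro card_mono) auto
    then have "card (critical A s t E) + card (crit1 \<inter> crit2) \<le> card crit1 + card crit2"
      using card_Un_Int[OF fin] by simp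
    then have "card (critical A s t E) + card (crit1 \<inter> crit2) + 4
        \<le> 2 * card X + 2 * card (A - X) + 2 + (card (twos s1 t EY) + card (twos s t2 EZ))"
      using 1 2 by simp
    also have "2 * card X + 2 * card (A - X) = 2 * card A"
      using card_AX 3(3) by simp
    finally show ?thesis using card_twos_split[OF S] by simp
  qed
qed

section \<open>Degree counting\<close>

lemma sum_card_fibre:
  assumes "finite E" "finite A" "s ` E \<subseteq> A"
  shows "(\<Sum>a\<in>A. card (fibre s E a)) = card E"
  using sum.group[OF assms, of "\<lambda>_. 1 :: nat"] by (simp add: fibre_def)

lemma six_card_le:
  assumes "finite E" "finite A" "s ` E \<subseteq> A" "\<And>a. a \<in> A \<Longrightarrow> 2 \<le> card (fibre s E a)"
  shows "6 * card A \<le> 2 * card E + card {e \<in> E. card (fibre s E (s e)) = 2}"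
proof -
  let ?T = "{e \<in> E. card (fibre s E (s e)) = 2}"
  have T: "card (fibre s ?T a) = (if card (fibre s E a) = 2 then 2 else 0)" for a
  proof -
    have "fibre s ?T a = (if card (fibre s E a) = 2 then fibre s E a else {})"
      by (auto simp: fibre_def)
    then show ?thesis by simp
  qed
  \<comment> \<open>A degree \<open>d \<ge> 2\<close> satisfies \<open>6 \<le> 2 * d\<close> unless
    \<open>d = 2\<close>, where the two edges at the vertex, both in \<open>?T\<close>, supply the
    missing 2.\<close>
  have "6 * card A = (\<Sum>a\<in>A. 6)" by simp
  also have "\<dots> \<le> (\<Sum>a\<in>A. 2 * card (fibre s E a) + card (fibre s ?T a))"
  proof (rule sum_mono)
    fix a assume "a \<in> A"
    then show "6 \<le> 2 * card (fibre s E a) + card (fibre s ?T a)"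
      using assms(4)[of a] by (simp add: T)
  qed
  also have "\<dots> = 2 * card E + card ?T"
    using sum_card_fibre[OF assms(1-3)] sum_card_fibre[of ?T A s] assms(1-3)
    by (simp add: sum.distrib image_subset_iff flip: sum_distrib_left)
  finally show ?thesis .
qed

text \<open>The bounds of \<open>six_card_le\<close> are added over the two sides. The edges with an
  end of degree two number at most \<open>card E\<close>, and those counted on both sides form
  \<open>twos\<close>.\<close>

lemma (in bigraph) twelve_card_le:
  assumes "surplus A s t E" "card A \<ge> 2"
  shows "12 * card A \<le> 5 * card E + card (twos s t E)"
proof -
  let ?S = "{e \<in> E. card (fibre s E (s e)) = 2}" and ?T = "{e \<in> E. card (fibre t E (t e)) = 2}"
  have "6 * card A \<le> 2 * card E + card ?S"
    using finE finA s_in card_fibre_s assms by (intro six_card_le) auto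
  moreover have "6 * card B \<le> 2 * card E + card ?T"
    using finE finB t_in card_fibre_t assms by (intro six_card_le) auto
  moreover have "card ?S + card ?T = card (?S \<union> ?T) + card (?S \<inter> ?T)"
    using finE by (intro card_Un_Int) auto
  moreover have "card (?S \<union> ?T) \<le> card E" using finE by (intro card_mono) auto
  moreover have "?S \<inter> ?T = twos s t E" by (auto simp: twos_def)
  ultimately show ?thesis using card_eq by simp
qed

section \<open>Hall's theorem\<close>

text \<open>Rado's argument: if some \<open>F i\<close> has two elements \<open>x\<close> and \<open>y\<close>, then
  one of them can be deleted from \<open>F i\<close>, since violations \<open>J\<close> and \<open>K\<close> caused by the two deletions
  contradict submodularity.\<close>

theorem hall:
  fixes F :: "'i \<Rightarrow> 'b set"
  assumes "finite I" "\<And>i. i \<in> I \<Longrightarrow> finite (F i)"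
    and "\<And>J. J \<subseteq> I \<Longrightarrow> card J \<le> card (\<Union>(F ` J))"
  shows "\<exists>g. inj_on g I \<and> (\<forall>i\<in>I. g i \<in> F i)"
  using assms(2,3)
proof (induction "\<Sum>i\<in>I. card (F i)" arbitrary: F rule: less_induct)
  case less
  note fin = less.prems(1) and hall = less.prems(2)
  show ?case
  proof (cases "\<forall>i\<in>I. card (F i) \<le> 1")
    case True
    have "\<exists>x. F i = {x}" if "i \<in> I" for i
    proof -
      have "card (F i) = Suc 0" using hall[of "{i}"] that True by (simp add: le_antisym)
      then show ?thesis by (simp add: card_1_singleton_iff)
    qed
    then obtain g where g: "\<And>i. i \<in> I \<Longrightarrow> F i = {g i}" by metis
    have "inj_on g I"
    proof (rule inj_onI, rule ccontr)
      fix i j assume ij: "i \<in> I" "j \<in> I" "g i = g j" "i \<noteq> j"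
      then have "\<Union>(F ` {i, j}) = {g i}" using g by auto
      then show False using hall[of "{i, j}"] ij by simp
    qed
    then show ?thesis using g by auto
  next
    case False
    then obtain i where i: "i \<in> I" "card (F i) \<ge> 2" by fastforce
    then obtain x y where xy: "x \<in> F i" "y \<in> F i" "x \<noteq> y"
      by (metis One_nat_def Suc_1 card_le_Suc0_iff_eq fin not_less_eq_eq)
    let ?F = "\<lambda>v. F(i := F i - {v})"
    \<comment> \<open>A choice function for \<open>?F v\<close> would serve \<open>F\<close> as
      well, so by induction on the total size Hall's condition fails for \<open>?F v\<close>. A
      violating set contains \<open>i\<close>, since only \<open>F i\<close> has changed.\<close>
    have violated: "\<exists>J\<subseteq>I. i \<in> J \<and> card (\<Union>(?F v ` J)) < card J"
      if v: "v \<in> F i" and no: "\<not> (\<exists>g. inj_on g I \<and> (\<forall>i\<in>I. g i \<in> F i))" for v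
    proof -
      have "\<not> (\<forall>J\<subseteq>I. card J \<le> card (\<Union>(?F v ` J)))"
      proof
        assume h: "\<forall>J\<subseteq>I. card J \<le> card (\<Union>(?F v ` J))"
        have "(\<Sum>j\<in>I. card (?F v j)) < (\<Sum>j\<in>I. card (F j))"
        proof (rule sum_strict_mono_ex1)
          have "card (F i - {v}) < card (F i)" using v fin i by (intro psubset_card_mono) auto
          then show "\<exists>j\<in>I. card (?F v j) < card (F j)" using i by (intro bexI[of _ i]) auto
          show "\<forall>j\<in>I. card (?F v j) \<le> card (F j)"
            using fin by (auto intro: card_mono)
        qed (rule assms(1))
        then have "\<exists>g. inj_on g I \<and> (\<forall>j\<in>I. g j \<in> ?F v j)"
          using fin h by (intro less.hyps) (auto split: if_splits)
        then obtain g where "inj_on g I" "\<forall>j\<in>I. g j \<in> ?F v j" by blast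
        then have "\<forall>j\<in>I. g j \<in> F j" by (metis DiffD1 fun_upd_apply)
        then show False using no \<open>inj_on g I\<close> by blast
      qed
      then obtain J where J: "J \<subseteq> I" "card (\<Union>(?F v ` J)) < card J" by (auto simp: not_le)
      moreover have "i \<in> J"
      proof (rule ccontr)
        assume "i \<notin> J"
        then have "?F v ` J = F ` J" by (auto simp: image_iff)
        then show False using J hall[of J] by simp
      qed
      ultimately show ?thesis by blast
    qed
    show ?thesis
    proof (rule ccontr)
      assume no: "\<not> ?thesis"
      obtain J where J: "J \<subseteq> I" "i \<in> J" "card (\<Union>(?F x ` J)) < card J"
        using violated[OF xy(1) no] by blast
      obtain K where K: "K \<subseteq> I" "i \<in> K" "card (\<Union>(?F y ` K)) < card K"
        using violated[OF xy(2) no] by blast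
      \<comment> \<open>As \<open>x \<noteq> y\<close>, the two reduced sets at \<open>i\<close>
        together give back \<open>F i\<close>, so \<open>?U \<union> ?V\<close> covers
        \<open>F\<close> on \<open>J \<union> K\<close>. The intersection covers \<open>F\<close> on
        \<open>J \<inter> K - {i}\<close>, only one index short, while the two strict violations
        lose two.\<close>
      let ?U = "\<Union>(?F x ` J)" and ?V = "\<Union>(?F y ` K)"
      have finJK: "finite J" "finite K" using J K assms(1) finite_subset by blast+
      have finUV: "finite ?U" "finite ?V" using finJK J K fin by (auto split: if_splits)
      have "card (J \<union> K) \<le> card (\<Union>(F ` (J \<union> K)))" using J K by (intro hall) auto
      also have "\<dots> \<le> card (?U \<union> ?V)"
      proof (rule card_mono)
        show "\<Union>(F ` (J \<union> K)) \<subseteq> ?U \<union> ?V" using J K xy by (fastforce split: if_splits)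
      qed (rule finite_UnI[OF finUV])
      finally have 1: "card (J \<union> K) \<le> card (?U \<union> ?V)" .
      have "card (J \<inter> K - {i}) \<le> card (\<Union>(F ` (J \<inter> K - {i})))" using J by (intro hall) auto
      also have "\<dots> \<le> card (?U \<inter> ?V)"
      proof (rule card_mono)
        show "\<Union>(F ` (J \<inter> K - {i})) \<subseteq> ?U \<inter> ?V" by (auto split: if_splits)
      qed (rule finite_Int[OF disjI1[OF finUV(1)]])
      finally have 2: "card (J \<inter> K) \<le> card (?U \<inter> ?V) + 1" using J K finJK by simp
      have "card J + card K = card (J \<union> K) + card (J \<inter> K)" using finJK by (rule card_Un_Int)
      moreover have "card ?U + card ?V = card (?U \<union> ?V) + card (?U \<inter> ?V)" using finUV by (rule card_Un_Int)
      ultimately show False using 1 2 J(3) K(3) by linarith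
    qed
  qed
qed

section \<open>Bipartite matching covered graphs\<close>

locale two_sided =
  fixes G :: "('v, 'e) multigraph" and A B :: "'v set" and s t :: "'e \<Rightarrow> 'v"
  assumes fin_loopless: "finite_loopless G"
    and AB_un: "A \<union> B = verts G" and AB_disj: "A \<inter> B = {}"
    and sA: "e \<in> edges G \<Longrightarrow> s e \<in> A" and tB: "e \<in> edges G \<Longrightarrow> t e \<in> B"
    and ends_eq: "e \<in> edges G \<Longrightarrow> ends G e = {s e, t e}"

lemma bipartite_two_sided:
  assumes "finite_loopless G" "bipartite G"
  obtains A B s t where "two_sided G A B s t"
proof -
  obtain A B where AB: "A \<union> B = verts G" "A \<inter> B = {}"
    and e: "\<forall>e\<in>edges G. \<exists>a\<in>A. \<exists>b\<in>B. ends G e = {a, b}"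
    using assms(2) unfolding bipartite_def by blast
  then obtain s t where "\<And>e. e \<in> edges G \<Longrightarrow> s e \<in> A \<and> t e \<in> B \<and> ends G e = {s e, t e}"
    by metis
  then show ?thesis using AB assms(1) by (intro that[of A B s t]) (simp add: two_sided_def)
qed

context two_sided
begin

lemma finAB: "finite A" "finite B" and finE: "finite (edges G)"
  using fin_loopless AB_un by (auto simp: finite_loopless_def dest: finite_subset[rotated])

lemma card_verts: "card (verts G) = card A + card B"
  using finAB AB_disj by (simp add: card_Un_disjoint flip: AB_un)

lemma bipartite: "bipartite G"
  unfolding bipartite_def
proof (intro exI conjI)
  show "\<forall>e\<in>edges G. \<exists>a\<in>A. \<exists>b\<in>B. ends G e = {a, b}" using sA tB ends_eq by blast
qed (rule AB_un AB_disj)+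

lemma two_sided_delete: "two_sided (delete_edge G e) A B s t"
  using fin_loopless AB_un AB_disj sA tB ends_eq
  by (auto simp: two_sided_def delete_edge_def finite_loopless_def)

lemma in_ends_iff:
  assumes "e \<in> edges G"
  shows "v \<in> A \<Longrightarrow> v \<in> ends G e \<longleftrightarrow> s e = v" "v \<in> B \<Longrightarrow> v \<in> ends G e \<longleftrightarrow> t e = v"
  using ends_eq[OF assms] sA[OF assms] tB[OF assms] AB_disj by auto

lemma degree_A: "v \<in> A \<Longrightarrow> degree G v = card (fibre s (edges G) v)"
  unfolding degree_def fibre_def by (metis (mono_tags, lifting) Collect_cong in_ends_iff(1))

lemma degree_B: "v \<in> B \<Longrightarrow> degree G v = card (fibre t (edges G) v)"
  unfolding degree_def fibre_def by (metis (mono_tags, lifting) Collect_cong in_ends_iff(2))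

lemma E2_eq_twos: "E2 G = twos s t (edges G)"
  unfolding E2_def twos_def using sA tB by (auto simp: ends_eq degree_A degree_B)

lemma perfect_matching_iff:
  "perfect_matching G M \<longleftrightarrow> M \<subseteq> edges G \<and> bij_betw s M A \<and> bij_betw t M B"
proof (cases "M \<subseteq> edges G")
  case True
  have bij: "bij_betw f M C \<longleftrightarrow> (\<forall>v\<in>C. \<exists>!e. e \<in> M \<and> f e = v)" if "f ` M \<subseteq> C"
    for f :: "'e \<Rightarrow> 'v" and C
    using that unfolding bij_betw_def inj_on_def by (auto 0 4 simp: image_iff Ball_def)
  have "bij_betw s M A \<longleftrightarrow> (\<forall>v\<in>A. \<exists>!e. e \<in> M \<and> s e = v)" using True sA by (intro bij) auto
  also have "\<dots> \<longleftrightarrow> (\<forall>v\<in>A. \<exists>!e. e \<in> M \<and> v \<in> ends G e)"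
    using True in_ends_iff(1) by (intro ball_cong refl arg_cong[where f=Ex1] ext) blast
  finally have 1: "bij_betw s M A \<longleftrightarrow> (\<forall>v\<in>A. \<exists>!e. e \<in> M \<and> v \<in> ends G e)" .
  have "bij_betw t M B \<longleftrightarrow> (\<forall>v\<in>B. \<exists>!e. e \<in> M \<and> t e = v)" using True tB by (intro bij) auto
  also have "\<dots> \<longleftrightarrow> (\<forall>v\<in>B. \<exists>!e. e \<in> M \<and> v \<in> ends G e)"
    using True in_ends_iff(2) by (intro ball_cong refl arg_cong[where f=Ex1] ext) blast
  finally have 2: "bij_betw t M B \<longleftrightarrow> (\<forall>v\<in>B. \<exists>!e. e \<in> M \<and> v \<in> ends G e)" .
  show ?thesis unfolding perfect_matching_def 1 2 using True by (simp add: ball_Un flip: AB_un)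
qed (simp add: perfect_matching_def)

text \<open>If \<open>X\<close> had at most \<open>card X\<close> neighbours, each perfect matching
  would match \<open>X\<close> onto all of them. Every edge lies in such a matching, so edges into
  the neighbourhood start in \<open>X\<close>, and \<open>X\<close> with its neighbours would be
  closed under adjacency, against connectedness.\<close>

lemma matching_covered_surplus:
  assumes mc: "matching_covered G"
  shows "bigraph A B s t (edges G)" "surplus A s t (edges G)" "card A \<ge> 2"
proof -
  let ?E = "edges G"
  have conn: "(u, v) \<in> (adjacent G)\<^sup>*" if "u \<in> verts G" "v \<in> verts G" for u v
    using mc that by (simp add: matching_covered_def connected_graph_def)
  have n4: "card (verts G) \<ge> 4" using mc by (simp add: matching_covered_def)
  have "\<not> card (verts G) \<le> Suc 0" using n4 by simp
  then obtain u v where uv: "u \<in> verts G" "v \<in> verts G" "u \<noteq> v"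
    using fin_loopless by (auto simp: card_le_Suc0_iff_eq finite_loopless_def)
  then obtain w where "(u, w) \<in> adjacent G" using conn by (meson converse_rtranclE)
  then obtain e0 where "e0 \<in> ?E" by (auto simp: adjacent_def)
  then obtain M where M: "perfect_matching G M" using mc by (auto simp: matching_covered_def)
  then have cAB: "card A = card B" using perfect_matching_iff bij_betw_same_card by metis
  show bg: "bigraph A B s t ?E"
    by unfold_locales (use finAB finE cAB sA tB in auto)
  interpret bigraph A B s t ?E by (rule bg)
  show "card A \<ge> 2" using n4 card_verts cAB by linarith
  have fill: "card (t ` {f \<in> M. s f \<in> X}) = card X" if "perfect_matching G M" "X \<subseteq> A" for M X
  proof -
    have b: "bij_betw s M A" "inj_on t M"
      using that by (auto simp: perfect_matching_iff bij_betw_def)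
    have "s ` {f \<in> M. s f \<in> X} = X" using b that(2) by (auto simp: bij_betw_def)
    moreover have "inj_on s {f \<in> M. s f \<in> X}" "inj_on t {f \<in> M. s f \<in> X}"
      using b by (auto simp: bij_betw_def inj_on_def)
    ultimately show ?thesis by (metis card_image)
  qed
  show "surplus A s t ?E"
    unfolding surplus_def
  proof (intro allI impI, elim conjE, rule ccontr)
    fix X assume X: "X \<noteq> {}" "X \<subset> A" and le: "\<not> card X < card (nbrs s t ?E X)"
    let ?Y = "nbrs s t ?E X"
    have XA: "X \<subseteq> A" using X(2) by (rule psubset_imp_subset)
    have Y: "t ` {f \<in> M. s f \<in> X} = ?Y" if "perfect_matching G M" for M
    proof (rule card_seteq)
      show "t ` {f \<in> M. s f \<in> X} \<subseteq> ?Y"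
        using that by (auto simp: perfect_matching_def nbrs_def)
      show "card ?Y \<le> card (t ` {f \<in> M. s f \<in> X})" using fill[OF that XA] le by simp
    qed simp
    have s_in_X: "s e \<in> X" if e: "e \<in> ?E" "t e \<in> ?Y" for e
    proof -
      obtain M' where M': "perfect_matching G M'" "e \<in> M'"
        using mc e by (auto simp: matching_covered_def)
      have "t e \<in> t ` {f \<in> M'. s f \<in> X}" unfolding Y[OF M'(1)] by (rule e(2))
      then obtain f where f: "f \<in> M'" "s f \<in> X" "t f = t e" by force
      then have "f = e" using M' by (auto simp: perfect_matching_iff bij_betw_def inj_on_def)
      then show ?thesis using f by simp
    qed
    have step: "v \<in> X \<union> ?Y" if uv: "(u, v) \<in> adjacent G" "u \<in> X \<union> ?Y" for u v
    proof -
      obtain e where e: "e \<in> ?E" "ends G e = {u, v}" using uv(1) by (auto simp: adjacent_def)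
      then have "{s e, t e} = {u, v}" using ends_eq by simp
      moreover have "s e \<notin> ?Y" "t e \<notin> X" using sA tB e AB_disj XA nbrs_subset by blast+
      moreover have "t e \<in> ?Y" if "s e \<in> X" using that e by (auto simp: nbrs_def)
      ultimately show ?thesis using uv(2) s_in_X[OF e(1)] by (auto simp: doubleton_eq_iff)
    qed
    have closed: "v \<in> X \<union> ?Y" if "(u, v) \<in> (adjacent G)\<^sup>*" "u \<in> X" for u v
      using that by (induction rule: rtrancl_induct) (use step in blast)+
    obtain x where x: "x \<in> X" using X by blast
    obtain a where a: "a \<in> A" "a \<notin> X" using X(2) by blast
    have "a \<in> X \<union> ?Y" using x a XA AB_un by (intro closed[OF conn x]) auto
    then show False using a nbrs_subset AB_disj by blast
  qed
qed

text \<open>Any edge \<open>e\<close> extends to a perfect matching by Hall's theorem for the other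
  vertices of \<open>A\<close>: the surplus of one pays for forbidding \<open>t e\<close>.\<close>

lemma surplus_matching_covered:
  assumes "card A = card B" and S: "surplus A s t (edges G)" and n4: "card (verts G) \<ge> 4"
  shows "matching_covered G"
proof -
  let ?E = "edges G"
  interpret bigraph A B s t ?E
    by unfold_locales (use finAB finE assms(1) sA tB in auto)
  have c2: "card A \<ge> 2" using n4 card_verts card_eq by linarith
  have "\<exists>M. perfect_matching G M \<and> e \<in> M" if e: "e \<in> ?E" for e
  proof -
    let ?I = "A - {s e}" and ?F = "\<lambda>a. nbrs s t ?E {a} - {t e}"
    have "card J \<le> card (\<Union>(?F ` J))" if J: "J \<subseteq> ?I" for J
    proof (cases "J = {}")
      case False
      have "J \<subset> A" using J sA[OF e] by (intro psubsetI) auto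
      then have "card J + 1 \<le> card (nbrs s t ?E J)" by (intro surplusD[OF S False])
      also have "\<dots> \<le> card (nbrs s t ?E J - {t e}) + 1"
        by (simp add: card_Diff_singleton_if) linarith
      also have "nbrs s t ?E J - {t e} = \<Union>(?F ` J)" by (auto simp: nbrs_def)
      finally show ?thesis by simp
    qed simp
    then have "\<exists>g. inj_on g ?I \<and> (\<forall>a\<in>?I. g a \<in> ?F a)"
      using finA by (intro hall) auto
    then obtain g where g: "inj_on g ?I" "\<And>a. a \<in> ?I \<Longrightarrow> g a \<in> ?F a" by blast
    have "\<exists>f\<in>?E. s f = a \<and> t f = g a" if "a \<in> ?I" for a
      using g(2)[OF that] by (auto simp: nbrs_def)
    then obtain h where h: "\<And>a. a \<in> ?I \<Longrightarrow> h a \<in> ?E \<and> s (h a) = a \<and> t (h a) = g a" by metis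
    let ?M = "insert e (h ` ?I)"
    have "inj_on s ?M" using h by (auto simp: inj_on_def)
    moreover have "s ` ?M = A"
    proof -
      have "s ` h ` ?I = ?I" using h by (force simp: image_iff)
      then show ?thesis using sA[OF e] by auto
    qed
    ultimately have bs: "bij_betw s ?M A" by (simp add: bij_betw_def)
    have injt: "inj_on t ?M"
    proof (rule inj_onI)
      fix p q assume pq: "p \<in> ?M" "q \<in> ?M" "t p = t q"
      have ne: "t (h a) \<noteq> t e" if "a \<in> ?I" for a using h[OF that] g(2)[OF that] by auto
      show "p = q"
      proof (cases "p = e \<or> q = e")
        case True
        then show ?thesis using pq ne by (metis imageE insertE)
      next
        case False
        then obtain a b where ab: "p = h a" "q = h b" "a \<in> ?I" "b \<in> ?I" using pq by auto
        then have "g a = g b" using h pq(3) by metis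
        then show ?thesis using g(1) ab by (metis inj_onD)
      qed
    qed
    have "t ` ?M = B"
    proof (rule card_subset_eq[OF finB])
      show "t ` ?M \<subseteq> B" using h e tB by auto
      show "card (t ` ?M) = card B"
        using card_image[OF injt] bij_betw_same_card[OF bs] card_eq by simp
    qed
    then have "bij_betw t ?M B" using injt by (simp add: bij_betw_def)
    moreover have "?M \<subseteq> ?E" using e h by auto
    ultimately show ?thesis using bs by (intro exI[of _ ?M]) (simp add: perfect_matching_iff)
  qed
  moreover have "connected_graph G"
    unfolding connected_graph_def
  proof (intro conjI ballI)
    show "verts G \<noteq> {}" using n4 by auto
    fix u v assume u: "u \<in> verts G" and v: "v \<in> verts G"
    \<comment> \<open>The component of \<open>u\<close>. If it split \<open>A\<close>, surplus on
      both parts would give \<open>card B \<ge> card A + 2\<close>.\<close>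
    define C where "C = {v. (u, v) \<in> (adjacent G)\<^sup>*}"
    have iff: "s e \<in> C \<longleftrightarrow> t e \<in> C" if "e \<in> ?E" for e
    proof -
      have "(s e, t e) \<in> adjacent G" "(t e, s e) \<in> adjacent G"
        using that ends_eq by (auto simp: adjacent_def intro!: bexI[of _ e])
      then show ?thesis by (auto simp: C_def intro: rtrancl_into_rtrancl)
    qed
    have uC: "u \<in> C" by (simp add: C_def)
    have nA: "\<exists>e\<in>?E. t e = b" if "b \<in> B" for b
      using nbrs_all[OF S c2] that by (auto simp: nbrs_def)
    have ne: "A \<inter> C \<noteq> {}"
    proof (cases "u \<in> A")
      case False
      then have "u \<in> B" using u AB_un by auto
      then obtain e where "e \<in> ?E" "t e = u" using nA by blast
      then show ?thesis using iff uC sA by auto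
    qed (use uC in auto)
    have "A \<subseteq> C"
    proof (rule ccontr)
      assume "\<not> A \<subseteq> C"
      then obtain a where a: "a \<in> A" "a \<notin> C" by blast
      obtain a' where a': "a' \<in> A" "a' \<in> C" using ne by blast
      have "card (A \<inter> C) + 1 \<le> card (nbrs s t ?E (A \<inter> C))"
        by (rule surplusD[OF S]) (use a a' in auto)
      also have "\<dots> \<le> card (B \<inter> C)"
        using finB iff tB by (intro card_mono) (auto simp: nbrs_def)
      finally have 1: "card (A \<inter> C) + 1 \<le> card (B \<inter> C)" .
      have "card (A - C) + 1 \<le> card (nbrs s t ?E (A - C))"
        by (rule surplusD[OF S]) (use a a' in auto)
      also have "\<dots> \<le> card (B - C)"
        using finB iff tB by (intro card_mono) (auto simp: nbrs_def)
      finally have 2: "card (A - C) + 1 \<le> card (B - C)" .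
      show False
        using 1 2 card_Int_Diff[OF finA, of C] card_Int_Diff[OF finB, of C] card_eq by linarith
    qed
    moreover have "B \<subseteq> C"
    proof
      fix b assume "b \<in> B"
      then obtain e where "e \<in> ?E" "t e = b" using nA by blast
      then show "b \<in> C" using iff sA \<open>A \<subseteq> C\<close> by blast
    qed
    ultimately show "(u, v) \<in> (adjacent G)\<^sup>*" using v AB_un by (auto simp: C_def)
  qed
  ultimately show ?thesis using fin_loopless n4 by (simp add: matching_covered_def)
qed

lemma minimal_iff_critical:
  assumes "matching_covered G"
  shows "minimal_matching_covered G \<longleftrightarrow> critical A s t (edges G) = edges G"
proof -
  interpret bigraph A B s t "edges G" by (rule matching_covered_surplus[OF assms])
  have "matching_covered (delete_edge G e) \<longleftrightarrow> surplus A s t (edges G - {e})" for e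
  proof -
    interpret D: two_sided "delete_edge G e" A B s t by (rule two_sided_delete)
    have eqs: "edges (delete_edge G e) = edges G - {e}" "verts (delete_edge G e) = verts G"
      by (simp_all add: delete_edge_def)
    have "card (verts (delete_edge G e)) \<ge> 4"
      unfolding eqs using assms unfolding matching_covered_def by blast
    then show ?thesis
      using D.matching_covered_surplus(2) D.surplus_matching_covered[OF card_eq]
      unfolding eqs by blast
  qed
  then show ?thesis using assms by (auto simp: minimal_matching_covered_def critical_def)
qed

end

section \<open>Bounds for minimal graphs and the containment\<close>

theorem minimal_bipartite_bounds:
  assumes "minimal_matching_covered G" "bipartite G"
  shows "card (edges G) + 2 \<le> card (verts G) + card (E2 G)"
    and "6 * card (verts G) \<le> 5 * card (edges G) + card (E2 G)"
proof -
  have mc: "matching_covered G" using assms by (simp add: minimal_matching_covered_def)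
  then have "finite_loopless G" by (simp add: matching_covered_def)
  then obtain A B s t where "two_sided G A B s t" using bipartite_two_sided assms(2) by metis
  then interpret two_sided G A B s t .
  note bg = matching_covered_surplus[OF mc]
  interpret bigraph A B s t "edges G" by (rule bg)
  have n: "card (verts G) = 2 * card A" using card_verts card_eq by simp
  have "critical A s t (edges G) = edges G" using minimal_iff_critical[OF mc] assms by simp
  moreover have "A \<noteq> {}" using bg(3) by auto
  ultimately show "card (edges G) + 2 \<le> card (verts G) + card (E2 G)"
    using card_critical_le[OF bg(1,2)] by (simp add: n E2_eq_twos)
  show "6 * card (verts G) \<le> 5 * card (edges G) + card (E2 G)"
    using twelve_card_le[OF bg(2,3)] by (simp add: n E2_eq_twos)
qed

lemma n_extremal_imp_extremal: "two_edge_n_extremal \<subseteq> two_edge_extremal"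
proof
  fix G :: "('v, 'e) multigraph" assume "G \<in> two_edge_n_extremal"
  then have G: "minimal_matching_covered G" "bipartite G"
    and eq: "real (card (E2 G)) = (real (card (verts G)) + 10) / 6"
    by (auto simp: two_edge_n_extremal_def)
  have "real (6 * card (E2 G)) = real (card (verts G) + 10)" using eq by simp
  then have "6 * card (E2 G) = card (verts G) + 10" by (simp only: of_nat_eq_iff)
  \<comment> \<open>Five times the first bound plus the second reads
    \<open>card (verts G) + 10 \<le> 6 * card (E2 G)\<close>; equality here makes the first bound
    tight.\<close>
  then have "card (edges G) + 2 = card (verts G) + card (E2 G)"
    using minimal_bipartite_bounds[OF G] by linarith
  then show "G \<in> two_edge_extremal" using G by (auto simp: two_edge_extremal_def)
qed

section \<open>A theta graph\<close>

text \<open>Two hubs \<open>0\<close> and \<open>5\<close> joined by the four paths \<open>0 - (5 + j) - j - 5\<close>, \<open>1 \<le> j \<le> 4\<close>.\<close>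

definition theta_s :: "nat \<Rightarrow> nat" where
  "theta_s e = (if e < 4 then 0 else if e < 8 then e - 3 else e - 7)"

definition theta_t :: "nat \<Rightarrow> nat" where
  "theta_t e = (if e < 4 then e + 6 else if e < 8 then e + 2 else 5)"

text \<open>Labels 0 to 3 are the edges at hub 0, labels 4 to 7 the middle edges of the paths,
  labels 8 to 11 the edges at hub 5. Hub 0 is on the side of 1 to 4, hub 5 on the side of 6 to
  9.\<close>

definition theta :: "(nat, nat) multigraph" where
  "theta = \<lparr>verts = {..<10}, edges = {..<12}, ends = (\<lambda>e. {theta_s e, theta_t e})\<rparr>"

interpretation theta: two_sided theta "{..<5}" "{5..<10}" theta_s theta_t
proof unfold_locales
  show "finite_loopless theta"
    by (auto simp: finite_loopless_def theta_def theta_s_def theta_t_def)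
qed (auto simp: theta_def theta_s_def theta_t_def split: if_splits)

lemma theta_simps [simp]: "verts theta = {..<10}" "edges theta = {..<12}"
  by (simp_all add: theta_def)

text \<open>Without hub 0, the neighbours of \<open>X\<close> are its partners \<open>j + 5\<close>
  and hub 5. With hub 0, all of 6 to 9 are reached, and any further vertex adds 5.\<close>

lemma theta_surplus: "surplus {..<5} theta_s theta_t {..<12}"
  unfolding surplus_def
proof (intro allI impI, elim conjE)
  fix X :: "nat set" assume X: "X \<noteq> {}" "X \<subset> {..<5}"
  let ?N = "nbrs theta_s theta_t {..<12} X"
  have finN: "finite ?N" by (simp add: nbrs_def)
  have XA: "X \<subseteq> {..<5}" using X(2) by (rule psubset_imp_subset)
  have finX: "finite X" using XA finite_subset by blast
  have hub: "5 \<in> ?N" if "j \<in> X" "j \<noteq> 0" for j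
    unfolding nbrs_def using that XA
    by (intro image_eqI[of _ _ "j + 7"]) (auto simp: theta_s_def theta_t_def)
  have leaf: "j + 5 \<in> ?N" if "j \<in> X" "j \<noteq> 0" for j
    unfolding nbrs_def using that XA
    by (intro image_eqI[of _ _ "j + 3"]) (auto simp: theta_s_def theta_t_def)
  have all: "{6..<10} \<subseteq> ?N" if "0 \<in> X"
  proof
    fix b :: nat assume "b \<in> {6..<10}"
    then show "b \<in> ?N" unfolding nbrs_def using that
      by (intro image_eqI[of _ _ "b - 6"]) (auto simp: theta_s_def theta_t_def)
  qed
  show "card X < card ?N"
  proof (cases "0 \<in> X")
    case False
    obtain j where "j \<in> X" using X by blast
    then have "5 \<in> ?N" using hub False by metis
    moreover have "(\<lambda>j. j + 5) ` X \<subseteq> ?N" using leaf False by auto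
    ultimately have "insert 5 ((\<lambda>j. j + 5) ` X) \<subseteq> ?N" by simp
    then have "card (insert 5 ((\<lambda>j. j + 5) ` X)) \<le> card ?N" using finN by (intro card_mono)
    moreover have "card (insert 5 ((\<lambda>j. j + 5) ` X)) = card X + 1"
      using False finX by (subst card_insert_disjoint) (auto simp: card_image)
    ultimately show ?thesis by simp
  next
    case True
    show ?thesis
    proof (cases "X = {0}")
      case True
      then show ?thesis using card_mono[OF finN all] by simp
    next
      case False
      then have "5 \<in> ?N" using hub True by blast
      then have "insert 5 {6..<10} \<subseteq> ?N" using all True by simp
      then have "card (insert 5 {6..<10::nat}) \<le> card ?N" using finN by (intro card_mono)
      moreover have "card X < card {..<5::nat}" using X(2) by (intro psubset_card_mono) auto
      ultimately show ?thesis by simp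
    qed
  qed
qed

interpretation theta_big: bigraph "{..<5}" "{5..<10}" theta_s theta_t "{..<12}"
  by unfold_locales (use theta.sA theta.tB in auto)

lemma theta_matching_covered: "matching_covered theta"
  using theta.surplus_matching_covered theta_surplus by simp

lemma fibre_theta:
  "a \<in> {1..<5} \<Longrightarrow> fibre theta_s {..<12} a = {a + 3, a + 7}"
  "b \<in> {6..<10} \<Longrightarrow> fibre theta_t {..<12} b = {b - 6, b - 2}"
  "fibre theta_s {..<12} 0 = {..<4}" "fibre theta_t {..<12} 5 = {8..<12}"
  by (auto simp: fibre_def theta_s_def theta_t_def split: if_splits)

lemma card_fibre_theta_s:
  assumes "e < 12"
  shows "card (fibre theta_s {..<12} (theta_s e)) = (if e < 4 then 4 else 2)"
proof (cases "e < 4")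
  case True
  then show ?thesis by (simp add: theta_s_def fibre_theta)
next
  case False
  then have "theta_s e \<in> {1..<5}" using assms by (auto simp: theta_s_def)
  then show ?thesis using False by (simp add: fibre_theta(1))
qed

lemma card_fibre_theta_t:
  assumes "e < 12"
  shows "card (fibre theta_t {..<12} (theta_t e)) = (if e < 8 then 2 else 4)"
proof (cases "e < 8")
  case True
  then have "theta_t e \<in> {6..<10}" by (auto simp: theta_t_def)
  then have "fibre theta_t {..<12} (theta_t e) = {theta_t e - 6, theta_t e - 2}" "6 \<le> theta_t e"
    by (auto simp: fibre_theta(2))
  then show ?thesis using True by auto
next
  case False
  then show ?thesis by (simp add: theta_t_def fibre_theta)
qed

lemma theta_extremal: "theta \<in> two_edge_extremal"
proof -
  \<comment> \<open>Every edge has an end of degree two: \<open>theta_t e\<close> for the edges at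
    hub 0, \<open>theta_s e\<close> for all others.\<close>
  have "e \<in> critical {..<5} theta_s theta_t {..<12}" if "e < 12" for e
    using theta_big.fibre_s_critical[of e] theta_big.fibre_t_critical[of e] card_fibre_theta_s card_fibre_theta_t that
    by (cases "e < 4") auto
  then have "critical {..<5} theta_s theta_t {..<12} = {..<12}" by (auto simp: critical_def)
  then have "minimal_matching_covered theta"
    using theta.minimal_iff_critical[OF theta_matching_covered] by simp
  moreover note theta.bipartite
  moreover have "E2 theta = {4..<8}"
    unfolding theta.E2_eq_twos by (auto simp: twos_def card_fibre_theta_s card_fibre_theta_t split: if_splits)
  ultimately show ?thesis by (simp add: two_edge_extremal_def)
qed

section \<open>Separation of the isomorphism classes\<close>

lemma isomorphic_card_verts: "isomorphic G H \<Longrightarrow> card (verts G) = card (verts H)"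
  by (auto simp: isomorphic_def dest: bij_betw_same_card)

theorem corollary7p11:
  "(two_edge_n_extremal :: ('v, 'e) multigraph set) \<subseteq> two_edge_extremal \<and>
   iso_classes (two_edge_n_extremal :: (nat, nat) multigraph set) \<subset> iso_classes two_edge_extremal"
proof (intro conjI psubsetI)
  show "(two_edge_n_extremal :: ('v, 'e) multigraph set) \<subseteq> two_edge_extremal"
    by (rule n_extremal_imp_extremal)
  show "iso_classes (two_edge_n_extremal :: (nat, nat) multigraph set) \<subseteq> iso_classes two_edge_extremal"
    using n_extremal_imp_extremal unfolding iso_classes_def quotient_def by blast
  have "iso_rel `` {theta} \<in> iso_classes two_edge_extremal"
    unfolding iso_classes_def by (rule quotientI[OF theta_extremal])
  \<comment> \<open>A graph isomorphic to \<open>theta\<close> has ten vertices, so membership in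
    \<open>two_edge_n_extremal\<close> would need \<open>6 * card (E2 G) = 20\<close>, which has no
    integer solution.\<close>
  moreover have "iso_rel `` {theta} \<notin> iso_classes two_edge_n_extremal"
  proof
    assume "iso_rel `` {theta} \<in> iso_classes two_edge_n_extremal"
    then obtain G where G: "G \<in> two_edge_n_extremal" "iso_rel `` {theta} = iso_rel `` {G}"
      unfolding iso_classes_def by (auto elim: quotientE)
    have "theta \<in> iso_rel `` {theta}"
      using theta.fin_loopless isomorphic_refl by (auto simp: iso_rel_def)
    then have "(G, theta) \<in> iso_rel" using G(2) by blast
    then have "card (verts G) = 10" using isomorphic_card_verts by (fastforce simp: iso_rel_def)
    then have "real (6 * card (E2 G)) = real 20" using G(1) by (simp add: two_edge_n_extremal_def)
    then have "6 * card (E2 G) = 20" by (simp only: of_nat_eq_iff)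
    then show False by presburger
  qed
  ultimately show "iso_classes (two_edge_n_extremal :: (nat, nat) multigraph set) \<noteq> iso_classes two_edge_extremal"
    by metis
qed

end
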